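(* Let $n\ge 3$, $\lambda\in F$, and let $V_{2n}$ and $V_{2n-2}$ be the modules of the Klein four group $G$ defined in the context, with $G$-equivariant surjection $\phi:V_{2n}\to V_{2n-2}$ and induced inclusion $\phi^*:F[V_{2n-2}]\hookrightarrow F[V_{2n}]$. Let $S\subseteq F[V_{2n-2}]^G$ be a separating set for $V_{2n-2}$. Then $\phi^{*}(S)$ together with the set $T$ consisting of \[x_{n+1},\qquad N_G(x_1),\qquad f_{\lambda}:=\begin{cases}\operatorname{Tr}^{G}(x_{1}x_{2}^{3}) & \text{if }\lambda\ne 0,1,\\ N_{H_{2}}(x_1x_{n+2}+x_{2}x_{n+1}) & \text{if }\lambda\in\{0,1\},\end{cases}\] \[\operatorname{Tr}^G(x_1x_{i}x_{i+1})\quad\text{for } 2\le i\le n-1,\] is a separating set for $V_{2n}$.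
   Context: $F$ is an algebraically closed field of characteristic $2$ and $G=\{\iota,\sigma_1,\sigma_2,\sigma_3\}$ is the Klein four group with identity $\iota$ (so $\sigma_2=\sigma_1\sigma_3$); $H_2=\{\iota,\sigma_2\}$. For $\lambda\in F$ and $n\geq 1$, $V_{2n}=F^{2n}$ with $G$ acting by $\sigma_{1}\mapsto\begin{pmatrix} I_{n}&I_{n}\\ 0& I_{n}\end{pmatrix}$, $\sigma_{3}\mapsto\begin{pmatrix} I_{n}&J_{\lambda}\\ 0& I_{n}\end{pmatrix}$, where $J_\lambda$ is the upper triangular Jordan block of size $n$ with eigenvalue $\lambda$. $F[V]=S(V^* )$ has the action $\sigma(f)=f\circ\sigma^{-1}$, and $F[V]^G$ is the ring of invariants. Write $F[V_{2n}]=F[x_1,\dots,x_{2n}]$ with $x_i$ the coordinate functions; then $\sigma_1x_i=x_i+x_{n+i}$ for $1\le i\le n$, $\sigma_3x_i=x_i+\lambda x_{n+i}+x_{n+i+1}$ for $1\le i\le n-1$, $\sigma_3x_n=x_n+\lambda x_{2n}$, and $x_{n+1},\dots,x_{2n}$ are invariant. The module $V_{2n-2}$ is the one defined in the same way with $n-1$ in place of $n$ and the same $\lambda$. The surjection $\phi:V_{2n}\to V_{2n-2}$ is $(a_1,\dots,a_n,a_{n+1},\dots,a_{2n})\mapsto(a_2,\dots,a_n,a_{n+2},\dots,a_{2n})$, so that $\phi^*$, $f\mapsto f\circ\phi$, identifies $F[V_{2n-2}]$ with the subalgebra $F[x_2,\dots,x_n,x_{n+2},\dots,x_{2n}]$ of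 $F[V_{2n}]$. For $f\in F[V]$, $\operatorname{Tr}^G(f)=\sum_{\sigma\in G}\sigma(f)$ and, for a subgroup $H\subseteq G$, $N_H(f)=\prod_{\sigma\in H}\sigma(f)$. A subset $A\subseteq F[V]^G$ is a separating set for $V$ if for all $u,w\in V$: $f(u)=f(w)$ for all $f\in A$ implies $f(u)=f(w)$ for all $f\in F[V]^G$. *)

theory Defs
  imports
    "HOL-Algebra.Group"
    "HOL-Library.FuncSet"
    "HOL-Computational_Algebra.Polynomial"
    "Jordan_Normal_Form.Jordan_Normal_Form"
begin

datatype klein = Iota | Sigma1 | Sigma2 | Sigma3

fun klein_mult :: "klein \<Rightarrow> klein \<Rightarrow> klein" where
  "klein_mult Iota h = h"
| "klein_mult g Iota = g"
| "klein_mult Sigma1 Sigma1 = Iota"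
| "klein_mult Sigma1 Sigma2 = Sigma3"
| "klein_mult Sigma1 Sigma3 = Sigma2"
| "klein_mult Sigma2 Sigma1 = Sigma3"
| "klein_mult Sigma2 Sigma2 = Iota"
| "klein_mult Sigma2 Sigma3 = Sigma1"
| "klein_mult Sigma3 Sigma1 = Sigma2"
| "klein_mult Sigma3 Sigma2 = Sigma1"
| "klein_mult Sigma3 Sigma3 = Iota"

definition klein_group :: "klein monoid" where
  "klein_group = \<lparr>carrier = {Iota, Sigma1, Sigma2, Sigma3}, mult = klein_mult, one = Iota\<rparr>"

lemma group_klein_group: "group klein_group"
proof (rule groupI)
  fix x y z
  assume "x \<in> carrier klein_group" "y \<in> carrier klein_group" "z \<in> carrier klein_group"
  show "x \<otimes>\<^bsub>klein_group\<^esub> y \<otimes>\<^bsub>klein_group\<^esub> z = x \<otimes>\<^bsub>klein_group\<^esub> (y \<otimes>\<^bsub>klein_group\<^esub> z)"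
    by (cases x; cases y; cases z) (simp_all add: klein_group_def)
next
  fix x y
  assume "x \<in> carrier klein_group" "y \<in> carrier klein_group"
  show "x \<otimes>\<^bsub>klein_group\<^esub> y \<in> carrier klein_group"
    by (cases x; cases y) (simp_all add: klein_group_def)
next
  fix x
  show "\<exists>y\<in>carrier klein_group. y \<otimes>\<^bsub>klein_group\<^esub> x = \<one>\<^bsub>klein_group\<^esub>"
    by (cases x) (auto simp: klein_group_def)
qed (simp_all add: klein_group_def)

definition H2 :: "klein set" where
  "H2 = {Iota, Sigma2}"

lemma subgroup_H2: "subgroup H2 klein_group"
proof (rule group.subgroupI[OF group_klein_group])
  have "inv\<^bsub>klein_group\<^esub> a = a" for a
    by (rule group.inv_equality[OF group_klein_group]; cases a; simp add: klein_group_def)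
  then show "inv\<^bsub>klein_group\<^esub> a \<in> H2" if "a \<in> H2" for a
    using that by simp
qed (auto simp: H2_def klein_group_def)

text \<open>Vectors and matrices are indexed from 0: the coordinate a_i of a vector is \<open>v $ (i - 1)\<close>.\<close>

definition V :: "nat \<Rightarrow> 'a::field vec set" where
  "V n = carrier_vec (2 * n)"

definition mat1 :: "nat \<Rightarrow> 'a::field mat" where
  "mat1 n = four_block_mat (1\<^sub>m n) (1\<^sub>m n) (0\<^sub>m n n) (1\<^sub>m n)"

definition mat3 :: "nat \<Rightarrow> 'a::field \<Rightarrow> 'a mat" where
  "mat3 n lam = four_block_mat (1\<^sub>m n) (jordan_block n lam) (0\<^sub>m n n) (1\<^sub>m n)"

fun rep :: "nat \<Rightarrow> 'a::field \<Rightarrow> klein \<Rightarrow> 'a mat" where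
  "rep n lam Iota = 1\<^sub>m (2 * n)"
| "rep n lam Sigma1 = mat1 n"
| "rep n lam Sigma2 = mat1 n * mat3 n lam"
| "rep n lam Sigma3 = mat3 n lam"

definition phi :: "nat \<Rightarrow> 'a::field vec \<Rightarrow> 'a vec" where
  "phi n v = vec (2 * (n - 1)) (\<lambda>j. if j < n - 1 then v $ (j + 1) else v $ (j + 2))"

text \<open>
  Over an infinite field S(V*) is the algebra of polynomial functions on V, which is what
  \<open>coord_ring\<close> is: it is generated by the coordinate functions, and they are algebraically
  independent by \<open>coord_algebraically_independent\<close> below. All functions on V are extensional,
  i.e. \<open>undefined\<close> outside V, so that equality of functions is equality on V.
\<close>

inductive_set coord_ring :: "nat \<Rightarrow> ('a::field vec \<Rightarrow> 'a) set" for n where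
  const: "(\<lambda>v\<in>V n. c) \<in> coord_ring n"
| coord: "i < 2 * n \<Longrightarrow> (\<lambda>v\<in>V n. v $ i) \<in> coord_ring n"
| add: "f \<in> coord_ring n \<Longrightarrow> g \<in> coord_ring n \<Longrightarrow> (\<lambda>v\<in>V n. f v + g v) \<in> coord_ring n"
| mult: "f \<in> coord_ring n \<Longrightarrow> g \<in> coord_ring n \<Longrightarrow> (\<lambda>v\<in>V n. f v * g v) \<in> coord_ring n"

definition X :: "nat \<Rightarrow> nat \<Rightarrow> 'a::field vec \<Rightarrow> 'a" where
  "X n i = (\<lambda>v\<in>V n. v $ (i - 1))"

definition act :: "nat \<Rightarrow> 'a::field \<Rightarrow> klein \<Rightarrow> ('a vec \<Rightarrow> 'a) \<Rightarrow> 'a vec \<Rightarrow> 'a" where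
  "act n lam g f = (\<lambda>v\<in>V n. f (rep n lam (inv\<^bsub>klein_group\<^esub> g) *\<^sub>v v))"

definition invariants :: "nat \<Rightarrow> 'a::field \<Rightarrow> ('a vec \<Rightarrow> 'a) set" where
  "invariants n lam = {f \<in> coord_ring n. \<forall>g \<in> carrier klein_group. act n lam g f = f}"

definition Tr :: "nat \<Rightarrow> 'a::field \<Rightarrow> ('a vec \<Rightarrow> 'a) \<Rightarrow> 'a vec \<Rightarrow> 'a" where
  "Tr n lam f = (\<lambda>v\<in>V n. \<Sum>g\<in>carrier klein_group. act n lam g f v)"

definition Nm :: "nat \<Rightarrow> 'a::field \<Rightarrow> klein set \<Rightarrow> ('a vec \<Rightarrow> 'a) \<Rightarrow> 'a vec \<Rightarrow> 'a" where
  "Nm n lam H f = (\<lambda>v\<in>V n. \<Prod>g\<in>H. act n lam g f v)"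

definition phi_star :: "nat \<Rightarrow> ('a::field vec \<Rightarrow> 'a) \<Rightarrow> 'a vec \<Rightarrow> 'a" where
  "phi_star n f = compose (V n) f (phi n)"

definition separating_set :: "nat \<Rightarrow> 'a::field \<Rightarrow> ('a vec \<Rightarrow> 'a) set \<Rightarrow> bool" where
  "separating_set n lam A \<longleftrightarrow> A \<subseteq> invariants n lam \<and>
     (\<forall>u\<in>V n. \<forall>w\<in>V n. (\<forall>f\<in>A. f u = f w) \<longrightarrow> (\<forall>f\<in>invariants n lam. f u = f w))"

definition f_lam :: "nat \<Rightarrow> 'a::field \<Rightarrow> 'a vec \<Rightarrow> 'a" where
  "f_lam n lam =
     (if lam \<noteq> 0 \<and> lam \<noteq> 1 then Tr n lam (\<lambda>v. X n 1 v * X n 2 v ^ 3)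
      else Nm n lam H2 (\<lambda>v. X n 1 v * X n (n + 2) v + X n 2 v * X n (n + 1) v))"

definition T :: "nat \<Rightarrow> 'a::field \<Rightarrow> ('a vec \<Rightarrow> 'a) set" where
  "T n lam =
     {X n (n + 1), Nm n lam (carrier klein_group) (X n 1), f_lam n lam} \<union>
     {Tr n lam (\<lambda>v. X n 1 v * X n i v * X n (i + 1) v) | i. 2 \<le> i \<and> i \<le> n - 1}"

lemma rep_carrier: "rep n lam g \<in> carrier_mat (2 * n) (2 * n)"
  by (cases g) (auto simp: mat1_def mat3_def mult_2)

lemma V_split:
  assumes "v \<in> V n"
  obtains a b where "v = a @\<^sub>v b" "a \<in> carrier_vec n" "b \<in> carrier_vec n"
proof
  show "v = vec_first v n @\<^sub>v vec_last v n" using assms by (simp add: V_def mult_2)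
qed auto

lemma block_index:
  assumes "B \<in> carrier_mat n n" "v \<in> V n" "i < 2 * n"
  shows "(four_block_mat (1\<^sub>m n) B (0\<^sub>m n n) (1\<^sub>m n) *\<^sub>v v) $ i =
    (if i < n then v $ i + (\<Sum>j<n. B $$ (i, j) * v $ (n + j)) else v $ i)"
proof -
  obtain a b where v: "v = a @\<^sub>v b" "a \<in> carrier_vec n" "b \<in> carrier_vec n"
    using V_split[OF assms(2)] .
  have "four_block_mat (1\<^sub>m n) B (0\<^sub>m n n) (1\<^sub>m n) *\<^sub>v v = (1\<^sub>m n *\<^sub>v a + B *\<^sub>v b) @\<^sub>v (0\<^sub>m n n *\<^sub>v a + 1\<^sub>m n *\<^sub>v b)"
    unfolding v(1) by (rule four_block_mat_mult_vec) (use assms v in auto)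
  then show ?thesis using assms v
    by (auto simp: scalar_prod_def atLeast0LessThan intro!: sum.cong)
qed

lemma rep_Sigma1_index:
  assumes "v \<in> V n" "i < 2 * n"
  shows "(rep n lam Sigma1 *\<^sub>v v) $ i = (if i < n then v $ i + v $ (n + i) else v $ i)"
proof -
  have "(\<Sum>j<n. (1\<^sub>m n :: 'a mat) $$ (i, j) * v $ (n + j)) = v $ (n + i)" if "i < n"
  proof -
    have "(\<Sum>j<n. (1\<^sub>m n :: 'a mat) $$ (i, j) * v $ (n + j)) = (\<Sum>j<n. if j = i then v $ (n + j) else 0)"
      using that by (intro sum.cong) auto
    then show ?thesis using that by simp
  qed
  then show ?thesis using block_index[OF one_carrier_mat assms] by (simp add: mat1_def)
qed

lemma rep_Sigma3_index:
  assumes "v \<in> V n" "i < 2 * n"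
  shows "(rep n lam Sigma3 *\<^sub>v v) $ i =
    (if i + 1 < n then v $ i + lam * v $ (n + i) + v $ (n + i + 1)
     else if i < n then v $ i + lam * v $ (n + i) else v $ i)"
proof -
  have "(\<Sum>j<n. jordan_block n lam $$ (i, j) * v $ (n + j)) =
      lam * v $ (n + i) + (if i + 1 < n then v $ (n + i + 1) else 0)" if "i < n"
  proof -
    have "(\<Sum>j<n. jordan_block n lam $$ (i, j) * v $ (n + j)) =
        (\<Sum>j<n. (if j = i then lam * v $ (n + j) else 0) + (if j = i + 1 then v $ (n + j) else 0))"
      using that by (intro sum.cong) auto
    then show ?thesis using that by (simp add: sum.distrib)
  qed
  moreover have "jordan_block n lam \<in> carrier_mat n n" by simp
  ultimately show ?thesis using block_index[OF _ assms, of "jordan_block n lam"] by (simp add: mat3_def add.assoc)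
qed

lemma unipotent_mult:
  assumes "A \<in> carrier_mat n n" "B \<in> carrier_mat n n"
  shows "four_block_mat (1\<^sub>m n) A (0\<^sub>m n n) (1\<^sub>m n) * four_block_mat (1\<^sub>m n) B (0\<^sub>m n n) (1\<^sub>m n) =
    four_block_mat (1\<^sub>m n) (A + B) (0\<^sub>m n n) (1\<^sub>m n :: 'a::field mat)"
proof -
  have "A + B = B + A" using assms by (rule comm_add_mat)
  then show ?thesis using assms
    by (subst mult_four_block_mat[of _ n n _ n _ n _ _ n _ n]) auto
qed

lemma add_self_mat:
  assumes "CHAR('a::field) = 2" "(A::'a mat) \<in> carrier_mat n n"
  shows "A + A = 0\<^sub>m n n"
proof -
  have "of_nat CHAR('a) = (0::'a)" by (rule of_nat_CHAR)
  then have "(2::'a) = 0" by (simp add: assms(1))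
  then have "x + x = 0" for x :: 'a by (metis mult_2 mult_zero_left)
  then show ?thesis using assms(2) by (intro eq_matI) auto
qed

lemma rep_klein_mult:
  fixes lam :: "'a::field"
  assumes "CHAR('a) = 2"
  shows "rep n lam (g \<otimes>\<^bsub>klein_group\<^esub> h) = rep n lam g * rep n lam h"
proof -
  define B where "B A = four_block_mat (1\<^sub>m n) A (0\<^sub>m n n) (1\<^sub>m n :: 'a mat)" for A
  let ?J = "jordan_block n lam" and ?I = "1\<^sub>m n :: 'a mat"
  have J[simp]: "?J \<in> carrier_mat n n" by simp
  have BB: "B A * B A' = B (A + A')" if "A \<in> carrier_mat n n" "A' \<in> carrier_mat n n" for A A'
    unfolding B_def using that by (rule unipotent_mult)
  have B0: "B (0\<^sub>m n n) = 1\<^sub>m (2 * n)"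
    unfolding B_def by (intro eq_matI) auto
  have c: "?J + ?I = ?I + ?J" by (rule comm_add_mat) auto
  have s: "A + A = 0\<^sub>m n n" if "A \<in> carrier_mat n n" for A :: "'a mat"
    using add_self_mat[OF assms that] .
  have a1: "?I + (?I + ?J) = ?J"
    by (subst assoc_add_mat[symmetric, of _ n n]) (auto simp: s)
  have a2: "?J + (?I + ?J) = ?I"
    by (subst c[symmetric], subst assoc_add_mat[symmetric, of _ n n]) (auto simp: s)
  have a3: "(?I + ?J) + ?I = ?J" "(?I + ?J) + ?J = ?I"
    using a1 a2 comm_add_mat[of "?I + ?J" n n ?I] comm_add_mat[of "?I + ?J" n n ?J] by auto
  have r: "rep n lam Iota = B (0\<^sub>m n n)" "rep n lam Sigma1 = B ?I"
    "rep n lam Sigma3 = B ?J" "rep n lam Sigma2 = B (?I + ?J)"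
    by (simp_all add: B0 BB mat1_def mat3_def flip: B_def)
  have cr: "?I + ?J \<in> carrier_mat n n" by auto
  show ?thesis
    by (cases g; cases h) (simp_all add: klein_group_def r BB cr s a1 a2 a3 c del: rep.simps)
qed

lemma phi_equivariant:
  assumes "n \<ge> 2" "v \<in> V n"
  shows "phi n (rep n lam g *\<^sub>v v) = rep (n - 1) lam g *\<^sub>v phi n v"
proof -
  obtain m where n: "n = Suc m" using assms(1) by (cases n) auto
  have phi_nth: "phi n w $ j = (if j < m then w $ Suc j else w $ Suc (Suc j))" if "j < 2 * m"
    for w :: "'a vec" and j
    using that by (simp add: phi_def n)
  have pV: "phi n w \<in> V m" for w :: "'a vec" by (simp add: phi_def V_def n)
  have rV: "rep k lam g *\<^sub>v w \<in> V k" if "w \<in> V k" for k g w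
    using rep_carrier[of k lam g] that by (auto simp: V_def)
  have dims: "dim_vec (phi n (rep n lam g *\<^sub>v w)) = dim_vec (rep m lam g *\<^sub>v phi n w)" for g w
    using rep_carrier[of m lam g] by (simp add: phi_def n)
  have 1: "phi n (rep n lam Sigma1 *\<^sub>v w) = rep m lam Sigma1 *\<^sub>v phi n w" if "w \<in> V n" for w
  proof (rule eq_vecI[OF _ dims])
    fix i assume "i < dim_vec (rep m lam Sigma1 *\<^sub>v phi n w)"
    then have i: "i < 2 * m" by (simp only: dims[symmetric]) (simp add: phi_def n)
    then have "Suc i < 2 * n" "Suc (Suc i) < 2 * n" by (simp_all add: n)
    note r = this[THEN rep_Sigma1_index[OF that]]
    show "phi n (rep n lam Sigma1 *\<^sub>v w) $ i = (rep m lam Sigma1 *\<^sub>v phi n w) $ i"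
      unfolding phi_nth[OF i] r rep_Sigma1_index[OF pV i] using i by (auto simp: phi_nth[unfolded n] n)
  qed
  have 3: "phi n (rep n lam Sigma3 *\<^sub>v w) = rep m lam Sigma3 *\<^sub>v phi n w" if "w \<in> V n" for w
  proof (rule eq_vecI[OF _ dims])
    fix i assume "i < dim_vec (rep m lam Sigma3 *\<^sub>v phi n w)"
    then have i: "i < 2 * m" by (simp only: dims[symmetric]) (simp add: phi_def n)
    then have "Suc i < 2 * n" "Suc (Suc i) < 2 * n" by (simp_all add: n)
    note r = this[THEN rep_Sigma3_index[OF that]]
    show "phi n (rep n lam Sigma3 *\<^sub>v w) $ i = (rep m lam Sigma3 *\<^sub>v phi n w) $ i"
      unfolding phi_nth[OF i] r rep_Sigma3_index[OF pV i] using i by (auto simp: phi_nth[unfolded n] n)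
  qed
  have 2: "rep k lam Sigma2 *\<^sub>v w = rep k lam Sigma1 *\<^sub>v (rep k lam Sigma3 *\<^sub>v w)"
    if "w \<in> V k" for k w
    unfolding rep.simps
    using that rep_carrier[of k lam Sigma1, unfolded rep.simps]
      rep_carrier[of k lam Sigma3, unfolded rep.simps]
    by (intro assoc_mult_mat_vec) (auto simp: V_def)
  have "phi n (rep n lam g *\<^sub>v v) = rep m lam g *\<^sub>v phi n v"
  proof (cases g)
    case Iota
    have "v \<in> carrier_vec (2 * n)" "phi n v \<in> carrier_vec (2 * m)"
      using assms(2) pV by (simp_all add: V_def)
    then show ?thesis using Iota by simp
  next
    case Sigma1
    then show ?thesis using 1[OF assms(2)] by simp
  next
    case Sigma2
    then show ?thesis using 2[OF assms(2)] 2[OF pV] 1[OF rV[OF assms(2)]] 3[OF assms(2)] by metis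
  next
    case Sigma3
    then show ?thesis using 3[OF assms(2)] by simp
  qed
  then show ?thesis by (simp add: n)
qed

lemma infinite_UNIV_alg_closed: "infinite (UNIV :: 'a::alg_closed_field set)"
proof
  assume fin: "finite (UNIV :: 'a set)"
  define q where "q = (\<Prod>a\<in>UNIV. [:- a, 1:] :: 'a poly)"
  have "degree q = card (UNIV :: 'a set)"
    unfolding q_def by (subst degree_prod_eq_sum_degree) auto
  moreover have "card (UNIV :: 'a set) > 0" using fin by (simp add: card_gt_0_iff)
  ultimately have "degree (q + 1) > 0" by (simp add: degree_add_eq_left)
  then obtain x where "poly (q + 1) x = 0" using alg_closed_imp_poly_has_root by blast
  moreover have "poly q x = 0" using fin by (auto simp: q_def poly_prod)
  ultimately show False by simp
qed

lemma coord_algebraically_independent_aux: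
  fixes c :: "(nat \<Rightarrow> nat) \<Rightarrow> 'a::field"
  assumes inf: "infinite (UNIV :: 'a set)"
  shows "finite E \<Longrightarrow> \<forall>e\<in>E. \<forall>i\<ge>m. e i = 0 \<Longrightarrow>
    \<forall>v :: nat \<Rightarrow> 'a. (\<Sum>e\<in>E. c e * (\<Prod>i<m. v i ^ e i)) = 0 \<Longrightarrow> e \<in> E \<Longrightarrow> c e = 0"
proof (induction m arbitrary: E c e)
  case 0
  have z: "d = (\<lambda>_. 0)" if "d \<in> E" for d
    using 0(2) that by (simp add: fun_eq_iff)
  have "E = {e}"
    using z z[OF 0(4)] 0(4) by blast
  then show ?case using 0 by simp
next
  case (Suc m)
  define k where "k = e m"
  define E0 where "E0 = {d \<in> E. d m = k}"
  have inj: "inj_on (\<lambda>d. d(m := 0)) E0"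
  proof (rule inj_onI)
    fix d d' assume "d \<in> E0" "d' \<in> E0" "d(m := 0) = d'(m := 0)"
    then show "d = d'"
      unfolding E0_def by (metis (mono_tags) fun_upd_triv fun_upd_upd mem_Collect_eq)
  qed
  have z: "(\<Sum>d\<in>E0. c d * (\<Prod>i<m. v i ^ d i)) = 0" for v
  proof -
    define p where "p = (\<Sum>d\<in>E. monom (c d * (\<Prod>i<m. v i ^ d i)) (d m))"
    have "poly p t = 0" for t
    proof -
      have "(\<Sum>d\<in>E. c d * (\<Prod>i<Suc m. (v(m := t)) i ^ d i)) = 0" using Suc.prems(3) by blast
      then show ?thesis by (simp add: p_def poly_sum poly_monom mult.assoc)
    qed
    then have "p = 0" using inf poly_roots_finite[of p] by auto
    then have "coeff p k = 0" by simp
    then show ?thesis using Suc.prems(1)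
      by (simp add: p_def coeff_sum E0_def sum.inter_filter)
  qed
  have "c ((e(m := 0))(m := k)) = 0"
  proof (rule Suc.IH[of "(\<lambda>d. d(m := 0)) ` E0" "\<lambda>d. c (d(m := k))" "e(m := 0)"])
    show "finite ((\<lambda>d. d(m := 0)) ` E0)" using Suc.prems(1) by (simp add: E0_def)
    show "\<forall>d\<in>(\<lambda>d. d(m := 0)) ` E0. \<forall>i\<ge>m. d i = 0"
      using Suc.prems(2) by (auto simp: E0_def)
    show "e(m := 0) \<in> (\<lambda>d. d(m := 0)) ` E0" using Suc.prems(4) by (auto simp: E0_def k_def)
    show "\<forall>v. (\<Sum>d\<in>(\<lambda>d. d(m := 0)) ` E0. c (d(m := k)) * (\<Prod>i<m. v i ^ d i)) = 0"
    proof
      fix v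
      have "(\<Sum>d\<in>(\<lambda>d. d(m := 0)) ` E0. c (d(m := k)) * (\<Prod>i<m. v i ^ d i)) =
          (\<Sum>d\<in>E0. c d * (\<Prod>i<m. v i ^ d i))"
        by (subst sum.reindex[OF inj]) (auto simp: E0_def intro!: sum.cong)
      then show "(\<Sum>d\<in>(\<lambda>d. d(m := 0)) ` E0. c (d(m := k)) * (\<Prod>i<m. v i ^ d i)) = 0"
        using z by simp
    qed
  qed
  then show ?case by (simp add: k_def)
qed

lemma coord_algebraically_independent:
  fixes c :: "(nat \<Rightarrow> nat) \<Rightarrow> 'a::alg_closed_field"
  assumes "finite E" "\<forall>e\<in>E. \<forall>i\<ge>2 * n. e i = 0"
    and "\<forall>v\<in>V n. (\<Sum>e\<in>E. c e * (\<Prod>i<2 * n. (v $ i) ^ e i)) = 0"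
    and "e \<in> E"
  shows "c e = 0"
proof (rule coord_algebraically_independent_aux[OF infinite_UNIV_alg_closed assms(1,2) _ assms(4)])
  show "\<forall>v. (\<Sum>e\<in>E. c e * (\<Prod>i<2 * n. v i ^ e i)) = 0"
  proof
    fix v :: "nat \<Rightarrow> 'a"
    have "vec (2 * n) v \<in> V n" by (simp add: V_def)
    from assms(3)[rule_format, OF this]
    show "(\<Sum>e\<in>E. c e * (\<Prod>i<2 * n. v i ^ e i)) = 0" by simp
  qed
qed

end

theory Submission
  imports Defs
begin

text \<open>
  A set of invariants is separating as soon as points with equal values on it lie in one orbit. The
  converse holds because the invariants of a finite group separate its orbits
  (\<open>invariants_separate_orbits\<close>), and this is how the hypothesis on \<open>S\<close> is used.

  Let \<open>u\<close> and \<open>w\<close> have equal values on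
  \<open>phi_star n ` S \<union> T n lam\<close>. Since \<open>S\<close> separates, \<open>phi n u\<close> and \<open>phi n w\<close> are in one orbit; as \<open>phi\<close>
  is equivariant, \<open>u\<close> can be moved within its orbit until \<open>phi n u = phi n w\<close>. The map \<open>phi\<close> forgets
  \<open>x\<^sub>1\<close> and \<open>x\<^sub>n\<^sub>+\<^sub>1\<close>, and the latter belongs to \<open>T\<close>, so afterwards the points differ at most in the
  first coordinate, say by \<open>d\<close>. It remains to find a group element that adds \<open>d\<close> to the first
  coordinate of \<open>u\<close> and fixes the others (\<open>same_orbit\<close>).

  Write \<open>y\<^sub>i = x\<^sub>n\<^sub>+\<^sub>i\<close>, with \<open>y\<^sub>n\<^sub>+\<^sub>1 = 0\<close>, and suppose \<open>d \<noteq> 0\<close>. If \<open>h\<close> does not involve \<open>x\<^sub>1\<close>, then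
  \<open>Tr (x\<^sub>1 h)\<close> changes by \<open>d Tr h\<close> between the two points, so \<open>Tr h\<close> vanishes there whenever
  \<open>Tr (x\<^sub>1 h)\<close> is in \<open>T\<close>. For \<open>h = x\<^sub>i x\<^sub>i\<^sub>+\<^sub>1\<close> this says \<open>y\<^sub>i y\<^sub>i\<^sub>+\<^sub>2 = y\<^sub>i\<^sub>+\<^sub>1\<^sup>2\<close>, and descending from
  \<open>y\<^sub>n\<^sub>+\<^sub>1 = 0\<close> all of \<open>y\<^sub>3, \<dots>, y\<^sub>n\<close> vanish (\<open>inv_coord_vanish\<close>). Hence the group moves at most the
  first two coordinates of \<open>u\<close>.

  If \<open>y\<^sub>2 = 0\<close>, only the first one moves. The norm of \<open>x\<^sub>1\<close> is then \<open>N (x\<^sub>1)\<close> for an additive polynomial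
  \<open>N\<close> whose roots are the displacements of \<open>x\<^sub>1\<close> under the group; equal norms give \<open>N d = 0\<close>, so \<open>d\<close>
  is one of these displacements.

  If \<open>y\<^sub>2 \<noteq> 0\<close>, the function \<open>f_lam\<close> decides. For \<open>lam \<noteq> 0, 1\<close> it forces
  \<open>Tr (x\<^sub>2\<^sup>3) = lam (1 + lam) y\<^sub>2\<^sup>3\<close> to vanish, which is absurd. For \<open>lam \<in> {0, 1}\<close> one of \<open>\<sigma>\<^sub>3\<close>, \<open>\<sigma>\<^sub>2\<close> fixes
  \<open>x\<^sub>2\<close> and adds \<open>y\<^sub>2\<close> to \<open>x\<^sub>1\<close>, while \<open>f_lam\<close> is \<open>z (z + y\<^sub>2\<^sup>2)\<close> with
  \<open>z = x\<^sub>1 y\<^sub>2 + x\<^sub>2 y\<^sub>1\<close>; as \<open>z\<close> changes by \<open>d y\<^sub>2\<close>, equal values leave only \<open>d = y\<^sub>2\<close>.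
\<close>

section \<open>The action on points and on functions\<close>

lemma carrier_klein: "carrier klein_group = UNIV"
  by (auto simp: klein_group_def intro: klein.exhaust)

lemma inv_klein [simp]: "inv\<^bsub>klein_group\<^esub> g = g"
  by (rule group.inv_equality[OF group_klein_group]; cases g; simp add: klein_group_def)

lemma sum_klein: "(\<Sum>g\<in>UNIV. F g) = F Iota + F Sigma1 + F Sigma2 + F Sigma3"
  and prod_klein: "(\<Prod>g\<in>UNIV. P g) = P Iota * P Sigma1 * P Sigma2 * P Sigma3"
proof -
  have "(UNIV :: klein set) = {Iota, Sigma1, Sigma2, Sigma3}"
    by (auto intro: klein.exhaust)
  note U = this
  show "(\<Sum>g\<in>UNIV. F g) = F Iota + F Sigma1 + F Sigma2 + F Sigma3"
    and "(\<Prod>g\<in>UNIV. P g) = P Iota * P Sigma1 * P Sigma2 * P Sigma3"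
    unfolding U by (simp_all add: ac_simps)
qed

lemma bij_klein_mult: "bij (\<lambda>g. klein_mult g h)"
proof (rule o_bij)
  show "(\<lambda>g. klein_mult g h) \<circ> (\<lambda>g. klein_mult g h) = id"
  proof
    fix g show "((\<lambda>g. klein_mult g h) \<circ> (\<lambda>g. klein_mult g h)) g = id g"
      by (cases g; cases h) simp_all
  qed
  then show "(\<lambda>g. klein_mult g h) \<circ> (\<lambda>g. klein_mult g h) = id" .
qed

lemma rep_closed [simp]: "v \<in> V n \<Longrightarrow> rep n lam g *\<^sub>v v \<in> V n"
  using rep_carrier[of n lam g] by (auto simp: V_def)

lemma rep_Iota: "v \<in> V n \<Longrightarrow> rep n lam Iota *\<^sub>v v = v"
  by (simp add: V_def)

lemma rep_rep:
  fixes lam :: "'a::field"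
  assumes "CHAR('a) = 2" "v \<in> V n"
  shows "rep n lam g *\<^sub>v (rep n lam h *\<^sub>v v) = rep n lam (klein_mult g h) *\<^sub>v v"
proof -
  have "rep n lam (klein_mult g h) = rep n lam g * rep n lam h"
    using rep_klein_mult[OF assms(1), of n lam g h] by (simp add: klein_group_def)
  then show ?thesis
    using assms(2) by (simp add: V_def assoc_mult_mat_vec[OF rep_carrier rep_carrier] del: rep.simps)
qed

lemma act_apply: "v \<in> V n \<Longrightarrow> act n lam g f v = f (rep n lam g *\<^sub>v v)"
  by (simp add: act_def)

lemma Tr_apply: "v \<in> V n \<Longrightarrow> Tr n lam f v = (\<Sum>g\<in>UNIV. f (rep n lam g *\<^sub>v v))"
  by (simp add: Tr_def carrier_klein act_apply)

lemma Nm_apply: "v \<in> V n \<Longrightarrow> Nm n lam H f v = (\<Prod>g\<in>H. f (rep n lam g *\<^sub>v v))"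
  by (simp add: Nm_def act_apply)

lemma coord_ring_extensional: "f \<in> coord_ring n \<Longrightarrow> f \<in> extensional (V n)"
  by (induction rule: coord_ring.induct) (simp_all only: restrict_extensional)

lemma restrict_coord_ring: "f \<in> coord_ring n \<Longrightarrow> (\<lambda>v\<in>V n. f v) = f"
  by (simp add: extensional_restrict coord_ring_extensional)

lemma coord_ring_cong:
  assumes "f \<in> coord_ring n" "\<And>v. v \<in> V n \<Longrightarrow> f v = g v"
  shows "(\<lambda>v\<in>V n. g v) \<in> coord_ring n"
proof -
  have "(\<lambda>v\<in>V n. g v) = (\<lambda>v\<in>V n. f v)" using assms(2) by (intro restrict_ext) simp
  then show ?thesis using assms(1) by (simp only: restrict_coord_ring)
qed

lemma invariantsI:
  assumes "f \<in> coord_ring n" "\<And>g v. v \<in> V n \<Longrightarrow> f (rep n lam g *\<^sub>v v) = f v"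
  shows "f \<in> invariants n lam"
proof -
  have "act n lam g f = f" for g
  proof
    fix v show "act n lam g f v = f v"
      using assms coord_ring_extensional[OF assms(1)]
      by (cases "v \<in> V n") (auto simp: act_def extensional_def)
  qed
  then show ?thesis using assms(1) by (simp add: invariants_def)
qed

lemma invariants_rep:
  assumes "f \<in> invariants n lam" "v \<in> V n"
  shows "f (rep n lam g *\<^sub>v v) = f v"
proof -
  have "act n lam g f = f" using assms(1) by (auto simp: invariants_def carrier_klein)
  then show ?thesis using act_apply[OF assms(2), of lam g f] by simp
qed

section \<open>Polynomial functions, traces and norms\<close>

lemma coord_ring_plus:
  assumes "(\<lambda>v\<in>V n. f v) \<in> coord_ring n" "(\<lambda>v\<in>V n. g v) \<in> coord_ring n"
  shows "(\<lambda>v\<in>V n. f v + g v) \<in> coord_ring n"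
  by (rule coord_ring_cong[OF coord_ring.add[OF assms]]) simp

lemma coord_ring_times:
  assumes "(\<lambda>v\<in>V n. f v) \<in> coord_ring n" "(\<lambda>v\<in>V n. g v) \<in> coord_ring n"
  shows "(\<lambda>v\<in>V n. f v * g v) \<in> coord_ring n"
  by (rule coord_ring_cong[OF coord_ring.mult[OF assms]]) simp

lemma coord_ring_sum:
  assumes "\<And>i. i \<in> A \<Longrightarrow> (\<lambda>v\<in>V n. f i v) \<in> coord_ring n"
  shows "(\<lambda>v\<in>V n. \<Sum>i\<in>A. f i v) \<in> coord_ring n"
  using assms
proof (induction A rule: infinite_finite_induct)
  case (insert x F)
  have "(\<lambda>v\<in>V n. f x v + (\<Sum>i\<in>F. f i v)) \<in> coord_ring n"
    by (rule coord_ring_plus[OF insert.prems insert.IH[OF insert.prems]]) auto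
  then show ?case by (simp only: sum.insert[OF insert.hyps(1,2)])
qed (simp_all add: coord_ring.const)

lemma coord_ring_prod:
  assumes "\<And>i. i \<in> A \<Longrightarrow> (\<lambda>v\<in>V n. f i v) \<in> coord_ring n"
  shows "(\<lambda>v\<in>V n. \<Prod>i\<in>A. f i v) \<in> coord_ring n"
  using assms
proof (induction A rule: infinite_finite_induct)
  case (insert x F)
  have "(\<lambda>v\<in>V n. f x v * (\<Prod>i\<in>F. f i v)) \<in> coord_ring n"
    by (rule coord_ring_times[OF insert.prems insert.IH[OF insert.prems]]) auto
  then show ?case by (simp only: prod.insert[OF insert.hyps(1,2)])
qed (simp_all add: coord_ring.const)

lemma coord_ring_X:
  assumes "1 \<le> i" "i \<le> 2 * n"
  shows "(\<lambda>v\<in>V n. X n i v) \<in> (coord_ring n :: ('a::field vec \<Rightarrow> 'a) set)"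
proof -
  have "X n i \<in> (coord_ring n :: ('a vec \<Rightarrow> 'a) set)"
    unfolding X_def using assms by (intro coord_ring.coord) auto
  then show ?thesis by (simp only: restrict_coord_ring)
qed

text \<open>Stated for maps between different modules so that it covers both the group action and the
  pullback along \<open>phi\<close>.\<close>

lemma coord_ring_substitute:
  assumes "f \<in> coord_ring n" "\<And>v. v \<in> V m \<Longrightarrow> L v \<in> V n"
    and "\<And>i. i < 2 * n \<Longrightarrow> (\<lambda>v\<in>V m. L v $ i) \<in> coord_ring m"
  shows "(\<lambda>v\<in>V m. f (L v)) \<in> coord_ring m"
  using assms(1)
proof induction
  case (const c)
  show ?case by (rule coord_ring_cong[OF coord_ring.const[where c = c]]) (simp add: assms(2))
next
  case (coord i)
  show ?case by (rule coord_ring_cong[OF assms(3)[OF coord]]) (simp add: assms(2))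
next
  case (add f g)
  show ?case by (rule coord_ring_cong[OF coord_ring.add[OF add.IH]]) (simp add: assms(2))
next
  case (mult f g)
  show ?case by (rule coord_ring_cong[OF coord_ring.mult[OF mult.IH]]) (simp add: assms(2))
qed

lemma coord_ring_rep:
  assumes "(\<lambda>v\<in>V n. f v) \<in> coord_ring n"
  shows "(\<lambda>v\<in>V n. f (rep n lam g *\<^sub>v v)) \<in> coord_ring n"
proof -
  have "(\<lambda>v\<in>V n. (rep n lam g *\<^sub>v v) $ i) \<in> coord_ring n" if i: "i < 2 * n" for i
  proof (rule coord_ring_cong)
    show "(\<lambda>v\<in>V n. \<Sum>j<2*n. rep n lam g $$ (i, j) * v $ j) \<in> coord_ring n"
      by (intro coord_ring_sum coord_ring_times coord_ring.const coord_ring.coord) simp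
    show "(\<lambda>v\<in>V n. \<Sum>j<2*n. rep n lam g $$ (i, j) * v $ j) v = (rep n lam g *\<^sub>v v) $ i"
      if "v \<in> V n" for v
      using i that rep_carrier[of n lam g]
      by (auto simp: V_def scalar_prod_def atLeast0LessThan intro!: sum.cong)
  qed
  from coord_ring_substitute[OF assms rep_closed this]
  have "(\<lambda>v\<in>V n. (\<lambda>v\<in>V n. f v) (rep n lam g *\<^sub>v v)) \<in> coord_ring n" .
  then show ?thesis by (rule coord_ring_cong) simp
qed

text \<open>Moving the point by \<open>h\<close> permutes the summands, by right translation on the group; the same
  holds for the factors of the norm below.\<close>

lemma Tr_invariant:
  fixes lam :: "'a::field"
  assumes "CHAR('a) = 2" "(\<lambda>v\<in>V n. f v) \<in> coord_ring n"
  shows "Tr n lam f \<in> invariants n lam"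
proof (rule invariantsI)
  show "Tr n lam f \<in> coord_ring n"
    unfolding Tr_def
    by (rule coord_ring_cong[OF coord_ring_sum[OF coord_ring_rep[OF assms(2)]]])
      (simp add: carrier_klein act_apply)
next
  fix h and v :: "'a vec" assume v: "v \<in> V n"
  have "(\<Sum>g\<in>UNIV. f (rep n lam (klein_mult g h) *\<^sub>v v)) = (\<Sum>g\<in>UNIV. f (rep n lam g *\<^sub>v v))"
    by (rule sum.reindex_bij_betw[OF bij_klein_mult])
  then show "Tr n lam f (rep n lam h *\<^sub>v v) = Tr n lam f v"
    using v assms(1) by (simp add: Tr_apply rep_rep)
qed

lemma Nm_coord_ring:
  assumes "(\<lambda>v\<in>V n. f v) \<in> coord_ring n"
  shows "Nm n lam H f \<in> coord_ring n"
  unfolding Nm_def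
  by (rule coord_ring_cong[OF coord_ring_prod[OF coord_ring_rep[OF assms]]]) (simp add: act_apply)

lemma Nm_invariant:
  fixes lam :: "'a::field"
  assumes "CHAR('a) = 2" "(\<lambda>v\<in>V n. f v) \<in> coord_ring n"
  shows "Nm n lam (carrier klein_group) f \<in> invariants n lam"
proof (rule invariantsI[OF Nm_coord_ring[OF assms(2)]])
  fix h and v :: "'a vec" assume v: "v \<in> V n"
  have "(\<Prod>g\<in>UNIV. f (rep n lam (klein_mult g h) *\<^sub>v v)) = (\<Prod>g\<in>UNIV. f (rep n lam g *\<^sub>v v))"
    by (rule prod.reindex_bij_betw[OF bij_klein_mult])
  then show "Nm n lam (carrier klein_group) f (rep n lam h *\<^sub>v v) = Nm n lam (carrier klein_group) f v"
    using v assms(1) by (simp add: Nm_apply rep_rep carrier_klein)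
qed

section \<open>Invariants separate orbits\<close>

text \<open>A coordinate that tells \<open>u\<close> from a single point can be scaled to take the values \<open>0\<close> and \<open>1\<close>
  at these points; such functions are then combined one point at a time.\<close>

lemma coord_ring_interpolate:
  fixes u :: "'a::field vec"
  assumes "u \<in> V n" "finite A" "A \<subseteq> V n" "u \<notin> A"
  shows "\<exists>f\<in>coord_ring n. f u = 0 \<and> (\<forall>v\<in>A. f v = 1)"
  using assms(2-4)
proof (induction A rule: finite_induct)
  case empty
  have "(\<lambda>v\<in>V n. 0) u = (0::'a)" using assms(1) by simp
  then show ?case using coord_ring.const[where n = n and c = 0] by blast
next
  case (insert w A)
  then obtain f where f: "f \<in> coord_ring n" "f u = 0" "\<forall>v\<in>A. f v = 1" by auto
  have "w \<noteq> u" "w \<in> V n" using insert by auto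
  then obtain i where i: "i < 2 * n" "w $ i \<noteq> u $ i"
    using assms(1) eq_vecI[of u w] by (auto simp: V_def)
  define c where "c = inverse (w $ i - u $ i)"
  define l where "l v = c * (v $ i + (- (u $ i)))" for v
  have l: "l u = 0" "l w = 1" using i by (simp_all add: l_def c_def)
  \<comment> \<open>This is \<open>1 - (1 - f) (1 - l)\<close>: it is \<open>1\<close> where \<open>f\<close> or \<open>l\<close> is \<open>1\<close>, and \<open>0\<close> where both are \<open>0\<close>.\<close>
  define h where "h = (\<lambda>v\<in>V n. f v + (l v + (- 1) * (f v * l v)))"
  have "(\<lambda>v\<in>V n. l v) \<in> coord_ring n"
    unfolding l_def by (intro coord_ring_times coord_ring_plus coord_ring.const coord_ring.coord i)
  then have "h \<in> coord_ring n"
    unfolding h_def using f(1) by (intro coord_ring_times coord_ring_plus coord_ring.const) (simp_all add: restrict_coord_ring)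
  moreover have "h u = 0" using assms(1) f l by (simp add: h_def)
  moreover have "h v = 1" if "v \<in> insert w A" for v
    using that insert.prems f l by (auto simp: h_def subset_eq)
  ultimately show ?case by blast
qed

text \<open>If \<open>u\<close> is not in the orbit of \<open>w\<close>, take a polynomial that is \<open>0\<close> at \<open>u\<close> and \<open>1\<close> on that orbit.
  Its norm is \<open>0\<close> at \<open>u\<close> and \<open>1\<close> at \<open>w\<close>. A trace would not do: in characteristic \<open>2\<close> the sum of the
  four values at \<open>w\<close> is \<open>0\<close>.\<close>

lemma invariants_separate_orbits:
  fixes lam :: "'a::field"
  assumes "CHAR('a) = 2" "u \<in> V n" "w \<in> V n"
    and "\<forall>f\<in>invariants n lam. f u = f w"
  shows "\<exists>g. w = rep n lam g *\<^sub>v u"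
proof (rule ccontr)
  assume no: "\<nexists>g. w = rep n lam g *\<^sub>v u"
  let ?A = "range (\<lambda>g. rep n lam g *\<^sub>v w)"
  have "u \<notin> ?A"
  proof
    assume "u \<in> ?A"
    then obtain g where "u = rep n lam g *\<^sub>v w" by auto
    then have "rep n lam g *\<^sub>v u = rep n lam (klein_mult g g) *\<^sub>v w"
      using rep_rep[OF assms(1,3)] by simp
    moreover have "klein_mult g g = Iota" by (cases g) auto
    ultimately show False using no rep_Iota[OF assms(3)] by metis
  qed
  moreover have "finite ?A"
  proof -
    have "(UNIV :: klein set) = {Iota, Sigma1, Sigma2, Sigma3}" by (auto intro: klein.exhaust)
    then have "finite (UNIV :: klein set)" by (metis finite.simps)
    then show ?thesis by simp
  qed
  moreover have "?A \<subseteq> V n" using assms(3) by auto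
  ultimately obtain f where f: "f \<in> coord_ring n" "f u = 0" "\<forall>v\<in>?A. f v = 1"
    using coord_ring_interpolate[OF assms(2)] by blast
  have "(\<lambda>v\<in>V n. f v) \<in> coord_ring n"
    using f(1) by (simp only: restrict_coord_ring)
  then have "Nm n lam (carrier klein_group) f u = Nm n lam (carrier klein_group) f w"
    using assms(1,4) Nm_invariant by blast
  moreover have "Nm n lam (carrier klein_group) f w = 1"
    using assms(3) f(3) by (simp add: Nm_apply carrier_klein)
  moreover have "Nm n lam (carrier klein_group) f u = 0"
    using assms(2) f(2) by (simp add: Nm_apply carrier_klein prod_klein rep_Iota del: rep.simps)
  ultimately show False by simp
qed

section \<open>The action in coordinates\<close>

text \<open>Indices count from \<open>0\<close>, so \<open>inv_coord n v k\<close> is \<open>y\<^sub>k\<^sub>+\<^sub>1\<close>. Extending these coordinates by \<open>0\<close> turns the exceptional last row of the Jordan block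
  into an instance of the general one.\<close>

definition inv_coord :: "nat \<Rightarrow> 'a::field vec \<Rightarrow> nat \<Rightarrow> 'a" where
  "inv_coord n v k = (if k < n then v $ (n + k) else 0)"

text \<open>The displacement of coordinate \<open>i\<close> (for \<open>i < n\<close>) under \<open>g\<close>.\<close>

fun shift :: "nat \<Rightarrow> 'a::field \<Rightarrow> klein \<Rightarrow> 'a vec \<Rightarrow> nat \<Rightarrow> 'a" where
  "shift n lam Iota v i = 0"
| "shift n lam Sigma1 v i = inv_coord n v i"
| "shift n lam Sigma2 v i = inv_coord n v i + (lam * inv_coord n v i + inv_coord n v (i + 1))"
| "shift n lam Sigma3 v i = lam * inv_coord n v i + inv_coord n v (i + 1)"

lemma rep_index:
  fixes lam :: "'a::field"
  assumes "CHAR('a) = 2" "v \<in> V n" "i < 2 * n"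
  shows "(rep n lam g *\<^sub>v v) $ i = (if i < n then v $ i + shift n lam g v i else v $ i)"
proof (cases g)
  case Iota
  then show ?thesis using rep_Iota[OF assms(2)] by (simp del: rep.simps)
next
  case Sigma1
  then show ?thesis using rep_Sigma1_index[OF assms(2,3)] by (simp add: inv_coord_def del: rep.simps)
next
  case Sigma2
  have "rep n lam Sigma2 *\<^sub>v v = rep n lam Sigma1 *\<^sub>v (rep n lam Sigma3 *\<^sub>v v)"
    using rep_rep[OF assms(1,2), of lam Sigma1 Sigma3] by (simp del: rep.simps)
  then show ?thesis
    using Sigma2 rep_Sigma1_index[OF rep_closed[OF assms(2)] assms(3), where lam = lam]
      rep_Sigma3_index[OF assms(2), of _ lam] assms(3)
    by (simp add: inv_coord_def add_ac del: rep.simps)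
next
  case Sigma3
  then show ?thesis using rep_Sigma3_index[OF assms(2,3)] by (simp add: inv_coord_def add_ac del: rep.simps)
qed

lemma X_rep:
  fixes lam :: "'a::field"
  assumes "CHAR('a) = 2" "v \<in> V n" "1 \<le> i" "i \<le> 2 * n"
  shows "X n i (rep n lam g *\<^sub>v v) = (if i \<le> n then v $ (i - 1) + shift n lam g v (i - 1) else v $ (i - 1))"
  using assms by (auto simp: X_def rep_index simp del: rep.simps)

text \<open>Together with full expansion and AC normalization, these rules decide polynomial identities
  with few variables in characteristic \<open>2\<close>: equal monomials become adjacent and cancel in pairs.\<close>

lemma char2_simps:
  assumes "CHAR('a::field) = 2"
  shows "(2::'a) = 0" "(3::'a) = 1" "(4::'a) = 0" "x + x = (0::'a)" "x + (x + z) = (z::'a)"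
proof -
  show two: "(2::'a) = 0" using of_nat_CHAR[where 'a='a] assms by simp
  have "(3::'a) = 2 + 1" "(4::'a) = 2 + 2" by simp_all
  then show "(3::'a) = 1" "(4::'a) = 0" by (simp_all only: two add_0_left)
  show "x + x = 0" for x :: 'a using two by (metis mult_2 mult_zero_left)
  then show "x + (x + z) = z" by (simp flip: add.assoc)
qed

text \<open>If \<open>\<alpha>\<close>, \<open>\<beta>\<close> are the displacements of \<open>x\<^sub>i\<close> under \<open>\<sigma>\<^sub>1\<close>, \<open>\<sigma>\<^sub>3\<close> and \<open>\<alpha>'\<close>, \<open>\<beta>'\<close> those of \<open>x\<^sub>i\<^sub>+\<^sub>1\<close>, all
  terms involving \<open>x\<close> cancel and \<open>\<alpha> \<beta>' + \<alpha>' \<beta>\<close> is left, in which the terms with \<open>lam\<close> cancel too.\<close>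

lemma Tr_mult_two_coords:
  fixes lam :: "'a::field"
  assumes "CHAR('a) = 2" "v \<in> V n" "1 \<le> i" "i + 1 \<le> n"
  shows "Tr n lam (\<lambda>v. X n i v * X n (i + 1) v) v =
    inv_coord n v (i - 1) * inv_coord n v (i + 1) + (inv_coord n v i)\<^sup>2"
proof -
  define p q a b c where "p = v $ (i - 1)" and "q = v $ i"
    and "a = inv_coord n v (i - 1)" and "b = inv_coord n v i" and "c = inv_coord n v (i + 1)"
  have "Tr n lam (\<lambda>v. X n i v * X n (i + 1) v) v =
      p * q + (p + a) * (q + b) + (p + (a + (lam * a + b))) * (q + (b + (lam * b + c)))
        + (p + (lam * a + b)) * (q + (lam * b + c))"
    using assms by (simp add: Tr_apply sum_klein X_rep p_def q_def a_def b_def c_def del: rep.simps)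
  also have "\<dots> = a * c + b\<^sup>2"
    by (simp add: char2_simps[OF assms(1)] power2_eq_square power3_eq_cube distrib_left distrib_right ac_simps)
  finally show ?thesis by (simp add: a_def b_def c_def)
qed

text \<open>Here \<open>x\<^sub>i\<close> is displaced by \<open>a\<close>, \<open>lam a\<close> and \<open>(1 + lam) a\<close>. These add up to \<open>0\<close>, hence so do
  their squares, and the trace is the sum of their cubes.\<close>

lemma Tr_cube:
  fixes lam :: "'a::field"
  assumes "CHAR('a) = 2" "v \<in> V n" "1 \<le> i" "i \<le> n" "inv_coord n v i = 0"
  shows "Tr n lam (\<lambda>v. X n i v ^ 3) v = lam * (1 + lam) * inv_coord n v (i - 1) ^ 3"
proof -
  define p a where "p = v $ (i - 1)" and "a = inv_coord n v (i - 1)"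
  have "Tr n lam (\<lambda>v. X n i v ^ 3) v =
      p ^ 3 + (p + a) ^ 3 + (p + (a + lam * a)) ^ 3 + (p + lam * a) ^ 3"
    using assms by (simp add: Tr_apply sum_klein X_rep p_def a_def del: rep.simps)
  also have "\<dots> = lam * (1 + lam) * a ^ 3"
    by (simp add: char2_simps[OF assms(1)] power2_eq_square power3_eq_cube distrib_left distrib_right ac_simps)
  finally show ?thesis by (simp add: a_def)
qed

section \<open>Membership of the new functions in the ring of invariants\<close>

text \<open>In characteristic \<open>2\<close> this is the determinant of the rows \<open>(x\<^sub>1, x\<^sub>2)\<close> and \<open>(y\<^sub>1, y\<^sub>2)\<close>. Since
  \<open>\<sigma>\<^sub>1\<close> adds the second row to the first, it fixes the determinant, which is why the norm over the
  complement \<open>H2\<close> of \<open>\<langle>\<sigma>\<^sub>1\<rangle>\<close> is invariant under the whole group.\<close>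

abbreviation minor12 :: "nat \<Rightarrow> 'a::field vec \<Rightarrow> 'a" where
  "minor12 n v \<equiv> X n 1 v * X n (n + 2) v + X n 2 v * X n (n + 1) v"

lemma minor12_rep:
  fixes lam :: "'a::field"
  assumes "CHAR('a) = 2" "n \<ge> 3" "v \<in> V n"
  shows "minor12 n (rep n lam Sigma1 *\<^sub>v v) = minor12 n v"
    and "minor12 n (rep n lam Sigma2 *\<^sub>v v) =
      minor12 n v + (inv_coord n v 1)\<^sup>2 + inv_coord n v 0 * inv_coord n v 2"
proof -
  define a b c where "a = inv_coord n v 0" and "b = inv_coord n v 1" and "c = inv_coord n v 2"
  have y: "v $ n = a" "v $ Suc n = b" using assms(2) by (simp_all add: a_def b_def inv_coord_def)
  have 0: "minor12 n v = v $ 0 * b + v $ 1 * a"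
    using assms by (simp add: X_def y)
  have "minor12 n (rep n lam Sigma1 *\<^sub>v v) = (v $ 0 + a) * b + (v $ 1 + b) * a"
    using assms by (simp add: X_rep y del: rep.simps) (simp add: a_def b_def)
  also have "\<dots> = v $ 0 * b + v $ 1 * a"
    by (simp add: char2_simps[OF assms(1)] power2_eq_square power3_eq_cube distrib_left distrib_right ac_simps)
  finally show "minor12 n (rep n lam Sigma1 *\<^sub>v v) = minor12 n v" using 0 by simp
  have "minor12 n (rep n lam Sigma2 *\<^sub>v v) =
      (v $ 0 + (a + (lam * a + b))) * b + (v $ 1 + (b + (lam * b + c))) * a"
    using assms by (simp add: X_rep y del: rep.simps) (simp add: a_def b_def c_def numeral_2_eq_2)
  also have "\<dots> = v $ 0 * b + v $ 1 * a + b\<^sup>2 + a * c"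
    by (simp add: char2_simps[OF assms(1)] power2_eq_square power3_eq_cube distrib_left distrib_right ac_simps)
  finally show "minor12 n (rep n lam Sigma2 *\<^sub>v v) =
      minor12 n v + (inv_coord n v 1)\<^sup>2 + inv_coord n v 0 * inv_coord n v 2"
    using 0 by (simp add: a_def b_def c_def)
qed

lemma Nm_H2_minor12:
  fixes lam :: "'a::field"
  assumes "CHAR('a) = 2" "n \<ge> 3" "v \<in> V n"
  shows "Nm n lam H2 (minor12 n) v = minor12 n v *
    (minor12 n v + (inv_coord n v 1)\<^sup>2 + inv_coord n v 0 * inv_coord n v 2)"
  using assms minor12_rep(2)[OF assms]
  by (simp add: Nm_apply H2_def rep_Iota del: rep.simps)

lemma Nm_H2_minor12_invariant:
  fixes lam :: "'a::field"
  assumes "CHAR('a) = 2" "n \<ge> 3"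
  shows "Nm n lam H2 (minor12 n) \<in> invariants n lam"
proof (rule invariantsI)
  show "Nm n lam H2 (minor12 n) \<in> coord_ring n"
    using assms by (intro Nm_coord_ring coord_ring_plus coord_ring_times coord_ring_X) auto
next
  fix g and v :: "'a vec" assume v: "v \<in> V n"
  have N: "Nm n lam H2 (minor12 n) w = minor12 n w * minor12 n (rep n lam Sigma2 *\<^sub>v w)"
    if "w \<in> V n" for w
    using that by (simp add: Nm_apply H2_def rep_Iota del: rep.simps)
  have 1: "minor12 n (rep n lam Sigma1 *\<^sub>v w) = minor12 n w" if "w \<in> V n" for w
    using minor12_rep(1)[OF assms that] .
  have 3: "minor12 n (rep n lam Sigma3 *\<^sub>v v) = minor12 n (rep n lam Sigma2 *\<^sub>v v)"
    using 1[OF rep_closed[OF v, of lam Sigma2]] by (simp add: rep_rep assms(1) v del: rep.simps)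
  show "Nm n lam H2 (minor12 n) (rep n lam g *\<^sub>v v) = Nm n lam H2 (minor12 n) v"
    unfolding N[OF rep_closed[OF v]] N[OF v] rep_rep[OF assms(1) v]
    by (cases g)
      (simp_all only: klein_mult.simps 1[OF v] 3 rep_Iota[OF v] mult.commute[of "minor12 n v"])
qed

lemma T_invariants:
  fixes lam :: "'a::field"
  assumes "CHAR('a) = 2" "n \<ge> 3"
  shows "T n lam \<subseteq> invariants n lam"
proof -
  have "X n (n + 1) \<in> invariants n lam"
  proof (rule invariantsI)
    show "X n (n + 1) \<in> coord_ring n"
      unfolding X_def using assms(2) by (intro coord_ring.coord) auto
    show "X n (n + 1) (rep n lam g *\<^sub>v v) = X n (n + 1) v" if "v \<in> V n" for g v
      using that assms by (subst X_rep) (auto simp: X_def)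
  qed
  moreover have "f_lam n lam \<in> invariants n lam"
    unfolding f_lam_def power3_eq_cube using Nm_H2_minor12_invariant[OF assms, of lam] assms
    by (simp only: split: if_split) (auto intro!: Tr_invariant coord_ring_times coord_ring_X)
  ultimately show ?thesis unfolding T_def using assms
    by (auto intro!: Nm_invariant Tr_invariant coord_ring_times coord_ring_X)
qed

lemma phi_closed: "phi n v \<in> V (n - 1)"
  by (simp add: phi_def V_def)

lemma phi_star_invariant:
  fixes lam :: "'a::field"
  assumes "n \<ge> 2" "f \<in> invariants (n - 1) lam"
  shows "phi_star n f \<in> invariants n lam"
proof (rule invariantsI)
  have "(\<lambda>v\<in>V n. f (phi n v)) \<in> coord_ring n"
  proof (rule coord_ring_substitute[OF _ phi_closed])
    show "f \<in> coord_ring (n - 1)" using assms(2) by (simp add: invariants_def)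
    fix i assume i: "i < 2 * (n - 1)"
    then have "i + 1 < 2 * n" "i + 2 < 2 * n" by auto
    note coord = this[THEN coord_ring.coord, where 'a = 'a]
    show "(\<lambda>v\<in>V n. phi n v $ i :: 'a) \<in> coord_ring n"
      using i coord by (cases "i < n - 1") (simp_all add: phi_def)
  qed
  then show "phi_star n f \<in> coord_ring n" by (simp add: phi_star_def compose_def)
next
  fix g and v :: "'a vec" assume "v \<in> V n"
  then show "phi_star n f (rep n lam g *\<^sub>v v) = phi_star n f v"
    using assms invariants_rep[OF assms(2) phi_closed]
    by (simp add: phi_star_def compose_def phi_equivariant del: rep.simps)
qed

section \<open>Points that differ in the first coordinate only\<close>

text \<open>The situation reached after \<open>u\<close> has been moved within its orbit to have the same image under
  \<open>phi\<close> as \<open>w\<close>.\<close>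

locale same_but_first =
  fixes lam :: "'a::field" and n :: nat and u w :: "'a vec"
  assumes char2: "CHAR('a) = 2"
    and n: "n \<ge> 3"
    and uw: "u \<in> V n" "w \<in> V n"
    and agree: "\<And>j. 0 < j \<Longrightarrow> j < 2 * n \<Longrightarrow> w $ j = u $ j"
begin

definition d :: 'a where "d = w $ 0 - u $ 0"

abbreviation y :: "nat \<Rightarrow> 'a" where "y \<equiv> inv_coord n u"

lemma w0: "w $ 0 = u $ 0 + d"
  by (simp add: d_def)

lemma inv_coord_w: "inv_coord n w = y"
  using n by (auto simp: inv_coord_def agree)

lemma shift_w: "shift n lam g w i = shift n lam g u i"
  by (cases g) (simp_all add: inv_coord_w)

lemma X_rep_w:
  assumes "2 \<le> i" "i \<le> 2 * n"
  shows "X n i (rep n lam g *\<^sub>v w) = X n i (rep n lam g *\<^sub>v u)"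
  using assms by (simp add: X_rep[OF char2] uw shift_w agree del: rep.simps)

text \<open>Every group element displaces the first coordinates of \<open>u\<close> and \<open>w\<close> equally, so along the two
  orbits these coordinates keep the constant difference \<open>d\<close>, which factors out of the sum.\<close>

lemma Tr_X1_mult:
  assumes "\<And>g. h (rep n lam g *\<^sub>v w) = h (rep n lam g *\<^sub>v u)"
  shows "Tr n lam (\<lambda>v. X n 1 v * h v) w = Tr n lam (\<lambda>v. X n 1 v * h v) u + d * Tr n lam h u"
proof -
  have "X n 1 (rep n lam g *\<^sub>v w) = X n 1 (rep n lam g *\<^sub>v u) + d" for g
    using n by (simp add: X_rep[OF char2] uw shift_w w0 del: rep.simps)
  then show ?thesis using assms
    by (simp add: Tr_apply uw sum.distrib sum_distrib_left distrib_right del: rep.simps)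
qed

lemma same_orbitI:
  assumes "shift n lam g u 0 = d" "\<And>i. 0 < i \<Longrightarrow> i < n \<Longrightarrow> shift n lam g u i = 0"
  shows "\<exists>g. w = rep n lam g *\<^sub>v u"
proof
  show "w = rep n lam g *\<^sub>v u"
  proof (rule eq_vecI)
    have dim: "dim_vec v = 2 * n" if "v \<in> V n" for v :: "'a vec"
      using that unfolding V_def by (rule carrier_vecD)
    note dims = dim[OF uw(2)] dim[OF rep_closed[OF uw(1)]]
    show "dim_vec w = dim_vec (rep n lam g *\<^sub>v u)" by (simp only: dims)
    fix i assume "i < dim_vec (rep n lam g *\<^sub>v u)"
    then have "i < 2 * n" by (simp only: dims)
    note index = rep_index[OF char2 uw(1) this, of lam g]
    show "w $ i = (rep n lam g *\<^sub>v u) $ i"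
    proof (cases "i = 0")
      case True
      then show ?thesis using n rep_index[OF char2 uw(1), of 0 lam g] assms(1) w0
        by (simp del: rep.simps shift.simps)
    next
      case False
      then have "w $ i = u $ i" using agree \<open>i < 2 * n\<close> by blast
      then show ?thesis using False assms(2)[of i] by (cases "i < n") (simp_all only: index if_True if_False add_0_right)
    qed
  qed
qed

text \<open>By descending induction: the relation for \<open>h = x\<^sub>i x\<^sub>i\<^sub>+\<^sub>1\<close> expresses \<open>y\<^sub>i\<^sub>+\<^sub>1\<^sup>2\<close> as a multiple of
  \<open>y\<^sub>i\<^sub>+\<^sub>2\<close>. The case \<open>i = 1\<close> is not among the functions of \<open>T\<close>, so the descent ends at \<open>y\<^sub>3\<close>, which is
  \<open>y 2\<close> in the indexing from \<open>0\<close>.\<close>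

lemma inv_coord_vanish:
  assumes "d \<noteq> 0" "2 \<le> k"
    and eq: "\<And>i. 2 \<le> i \<Longrightarrow> i \<le> n - 1 \<Longrightarrow>
      Tr n lam (\<lambda>v. X n 1 v * X n i v * X n (i + 1) v) w =
      Tr n lam (\<lambda>v. X n 1 v * X n i v * X n (i + 1) v) u"
  shows "y k = 0"
  using assms(2)
proof (induction "n - k" arbitrary: k)
  case 0
  then show ?case by (simp add: inv_coord_def)
next
  case (Suc m)
  then have k: "2 \<le> k" "k \<le> n - 1" by auto
  have "Tr n lam (\<lambda>v. X n 1 v * (X n k v * X n (k + 1) v)) w =
      Tr n lam (\<lambda>v. X n 1 v * (X n k v * X n (k + 1) v)) u"
    using eq[OF k] by (simp add: mult.assoc)
  moreover have "X n k (rep n lam g *\<^sub>v w) * X n (k + 1) (rep n lam g *\<^sub>v w) =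
      X n k (rep n lam g *\<^sub>v u) * X n (k + 1) (rep n lam g *\<^sub>v u)" for g
    using k by (simp add: X_rep_w del: rep.simps)
  ultimately have "d * Tr n lam (\<lambda>v. X n k v * X n (k + 1) v) u = 0"
    using Tr_X1_mult[of "\<lambda>v. X n k v * X n (k + 1) v"] by simp
  then have "y (k - 1) * y (k + 1) + (y k)\<^sup>2 = 0"
    using Tr_mult_two_coords[OF char2 uw(1), of k] k assms(1) by simp
  moreover have "y (k + 1) = 0" using Suc by auto
  ultimately show ?case by simp
qed

text \<open>Once \<open>y\<^sub>3, \<dots>, y\<^sub>n\<close> vanish, only the displacements of the first two coordinates are left, and
  unless \<open>d\<close> is the displacement of \<open>x\<^sub>1\<close> under some element that fixes \<open>x\<^sub>2\<close>, the two points are told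
  apart by the norm of \<open>x\<^sub>1\<close> (if \<open>y\<^sub>2 = 0\<close>) or by \<open>f_lam\<close> (if \<open>y\<^sub>2 \<noteq> 0\<close>).\<close>

lemma same_orbit:
  assumes eq: "\<And>f. f \<in> T n lam \<Longrightarrow> f w = f u"
  shows "\<exists>g. w = rep n lam g *\<^sub>v u"
proof (cases "d = 0")
  case True
  show ?thesis by (rule same_orbitI[of Iota]) (simp_all only: shift.simps True)
next
  case False
  have y2: "y k = 0" if "2 \<le> k" for k
    using inv_coord_vanish[OF False that] eq by (auto simp: T_def)
  show ?thesis
  proof (cases "y 1 = 0")
    case True
    with y2 have y1: "y k = 0" if "1 \<le> k" for k
      using that by (cases "k = 1") auto
    have sh: "shift n lam g u i = 0" if "0 < i" for g i
      using that by (cases g) (simp_all add: y1)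
    \<comment> \<open>The roots of \<open>N\<close>, with multiplicity, are the image of the group under the homomorphism
      \<open>g \<mapsto> shift n lam g u 0\<close>; this is why \<open>N\<close> is additive.\<close>
    define N where "N t = t * (t + y 0) * (t + (y 0 + lam * y 0)) * (t + lam * y 0)" for t
    have "N (w $ 0) = N (u $ 0)"
      using eq[of "Nm n lam (carrier klein_group) (X n 1)"] n uw
      by (simp add: T_def Nm_apply carrier_klein prod_klein X_rep[OF char2] shift_w
          inv_coord_w N_def y1 del: rep.simps)
    moreover have "N (u $ 0 + d) = N (u $ 0) + N d"
      unfolding N_def
      by (simp add: char2_simps[OF char2] power2_eq_square power3_eq_cube distrib_left distrib_right ac_simps)
    ultimately have "N d = 0" by (simp add: w0)
    then have "d + y 0 = 0 \<or> d + (y 0 + lam * y 0) = 0 \<or> d + lam * y 0 = 0"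
      using False by (auto simp: N_def)
    moreover have "d = c" if "d + c = 0" for c
      using that char2_simps(4)[OF char2, of c] by (metis add_right_cancel)
    moreover have "shift n lam Sigma1 u 0 = y 0" "shift n lam Sigma2 u 0 = y 0 + lam * y 0"
      "shift n lam Sigma3 u 0 = lam * y 0" by (simp_all add: y1)
    ultimately have "\<exists>g. shift n lam g u 0 = d" by metis
    then obtain g where "shift n lam g u 0 = d" ..
    then show ?thesis using sh by (rule same_orbitI)
  next
    case y1: False
    show ?thesis
    proof (cases "lam = 0 \<or> lam = 1")
      case lam: True
      let ?z = "minor12 n u"
      have z: "minor12 n w = ?z + d * y 1"
      proof -
        have "X n (n + 2) u = y 1" using n uw by (simp add: X_def inv_coord_def)
        moreover have "X n i w = X n i u" if "2 \<le> i" "i \<le> 2 * n" for i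
          using that uw agree[of "i - 1"] by (simp add: X_def)
        moreover have "X n 1 w = X n 1 u + d" using uw w0 by (simp add: X_def)
        ultimately show ?thesis using n by (simp add: distrib_right add_ac)
      qed
      have "Nm n lam H2 (minor12 n) w = Nm n lam H2 (minor12 n) u"
        using eq[of "f_lam n lam"] lam by (auto simp: T_def f_lam_def)
      then have "(?z + d * y 1) * (?z + d * y 1 + (y 1)\<^sup>2) = ?z * (?z + (y 1)\<^sup>2)"
        by (simp only: Nm_H2_minor12[OF char2 n] uw inv_coord_w y2 z) simp
      \<comment> \<open>Again additivity, now of \<open>t \<mapsto> t (t + s)\<close> with \<open>s = (y 1)\<^sup>2\<close>.\<close>
      moreover have "(z + e) * (z + e + s) = z * (z + s) + e * (e + s)" for z e s :: 'a
        by (simp add: char2_simps[OF char2] distrib_left distrib_right ac_simps)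
      ultimately have "d * y 1 * (d * y 1 + (y 1)\<^sup>2) = 0"
        by simp
      then have "d * (y 1)\<^sup>2 * (d + y 1) = 0"
        by (simp add: power2_eq_square algebra_simps)
      then have "d + y 1 = 0" using False y1 by simp
      then have d: "d = y 1" using char2_simps(4)[OF char2, of "y 1"] by (metis add_right_cancel)
      have y3: "y (Suc i) = 0" if "0 < i" for i using y2 that by simp
      from lam show ?thesis
      proof
        assume "lam = 0"
        show ?thesis by (rule same_orbitI[of Sigma3]) (simp_all add: d y3 \<open>lam = 0\<close>)
      next
        assume "lam = 1"
        show ?thesis
          by (rule same_orbitI[of Sigma2]) (simp_all add: d y3 \<open>lam = 1\<close> char2_simps[OF char2])
      qed
    next
      case lam: False
      have "Tr n lam (\<lambda>v. X n 1 v * X n 2 v ^ 3) w = Tr n lam (\<lambda>v. X n 1 v * X n 2 v ^ 3) u"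
        using eq[of "f_lam n lam"] lam by (auto simp: T_def f_lam_def)
      moreover have "X n 2 (rep n lam g *\<^sub>v w) ^ 3 = X n 2 (rep n lam g *\<^sub>v u) ^ 3" for g
        using n by (simp add: X_rep_w del: rep.simps)
      ultimately have "d * Tr n lam (\<lambda>v. X n 2 v ^ 3) u = 0"
        using Tr_X1_mult[of "\<lambda>v. X n 2 v ^ 3"] by simp
      then have "d * (lam * (1 + lam) * y 1 ^ 3) = 0"
        using Tr_cube[OF char2 uw(1), of 2] n y2[of 2] by simp
      moreover have "1 + lam \<noteq> 0"
        using lam char2_simps(4)[OF char2, of 1] by (metis add_left_cancel)
      ultimately show ?thesis using False y1 lam by simp
    qed
  qed
qed

end

theorem proposition4:
  fixes lam :: "'a::alg_closed_field" and n :: nat and S :: "('a vec \<Rightarrow> 'a) set"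
  assumes "CHAR('a) = 2"
    and "n \<ge> 3"
    and "S \<subseteq> invariants (n - 1) lam"
    and "separating_set (n - 1) lam S"
  shows "separating_set n lam (phi_star n ` S \<union> T n lam)"
  unfolding separating_set_def
proof (intro conjI ballI impI)
  have T: "T n lam \<subseteq> invariants n lam" using T_invariants assms(1,2) by blast
  then show "phi_star n ` S \<union> T n lam \<subseteq> invariants n lam"
    using assms(2,3) phi_star_invariant[of n _ lam] by auto
  fix u w :: "'a vec" and f
  assume u: "u \<in> V n" and w: "w \<in> V n" and f: "f \<in> invariants n lam"
    and eq: "\<forall>f\<in>phi_star n ` S \<union> T n lam. f u = f w"
  have "h (phi n u) = h (phi n w)" if "h \<in> S" for h
  proof -
    have "phi_star n h u = phi_star n h w" using eq that by blast
    then show ?thesis using u w by (simp add: phi_star_def compose_def)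
  qed
  then have "\<forall>h\<in>invariants (n - 1) lam. h (phi n u) = h (phi n w)"
    using assms(4) phi_closed unfolding separating_set_def by blast
  then obtain g where g: "phi n w = rep (n - 1) lam g *\<^sub>v phi n u"
    using invariants_separate_orbits[OF assms(1) phi_closed phi_closed] by blast
  \<comment> \<open>Values of invariants at \<open>u\<close> do not change when \<open>u\<close> is replaced by a point of its orbit.\<close>
  define u' where "u' = rep n lam g *\<^sub>v u"
  have u': "u' \<in> V n" using u by (simp add: u'_def)
  have phi: "phi n u' = phi n w"
    using g phi_equivariant[OF _ u, of lam g] assms(2) by (simp add: u'_def)
  have T': "h w = h u'" if "h \<in> T n lam" for h
    using that eq T invariants_rep[OF _ u] unfolding u'_def by (metis UnI2 subsetD)
  have agree: "w $ j = u' $ j" if j: "0 < j" "j < 2 * n" for j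
  proof -
    consider "j < n" | "j = n" | "n < j" by linarith
    then show ?thesis
    proof cases
      case 1
      then have "j - 1 < 2 * (n - 1)" "j - 1 < n - 1" "j - 1 + 1 = j" using j by auto
      then have "phi n v $ (j - 1) = v $ j" for v :: "'a vec"
        by (simp add: phi_def del: One_nat_def)
      then show ?thesis using phi by metis
    next
      case 2
      then show ?thesis using T'[of "X n (n + 1)"] u' w by (simp add: T_def X_def)
    next
      case 3
      then have "j - 2 < 2 * (n - 1)" "\<not> j - 2 < n - 1" "j - 2 + 2 = j" using j assms(2) by auto
      then have "phi n v $ (j - 2) = v $ j" for v :: "'a vec"
        by (simp add: phi_def del: One_nat_def)
      then show ?thesis using phi by metis
    qed
  qed
  interpret same_but_first lam n u' w
    using assms(1,2) u' w agree by unfold_locales auto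
  obtain h where "w = rep n lam h *\<^sub>v u'" using same_orbit T' by blast
  then show "f u = f w" using invariants_rep[OF f u'] invariants_rep[OF f u] by (simp add: u'_def)
qed

end
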